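(* Let $(R,S)$ be a partial field with $S$ finite. A tame matroid $M$ (possibly infinite) is $(R,S)$-paintable if and only if all its finite minors are $(R,S)$-paintable.
   Context: Matroids may be infinite, in the following sense: a matroid on a set $E$ is given by a family $\mathcal{I}\subseteq\mathcal{P}(E)$ of independent sets such that (I1) $\emptyset\in\mathcal{I}$; (I2) $\mathcal{I}$ is closed under subsets; (I3) whenever $I,I'\in\mathcal{I}$ with $I'$ maximal and $I$ not maximal, there is $x\in I'\setminus I$ with $I\cup\{x\}\in\mathcal{I}$; (IM) whenever $I\subseteq X\subseteq E$ and $I\in\mathcal{I}$, the set $\{I'\in\mathcal{I}\mid I\subseteq I'\subseteq X\}$ has a maximal element. Bases are maximal independent sets, circuits are minimal dependent sets; the dual $M^*$ has as bases the complements of bases of $M$, and cocircuits of $M$ are circuits of $M^*$. Deletion $M\backslash D$ has as independent sets the independent sets of $M$ disjoint from $D$; contraction is $M/C=(M^*\backslash C)^*$; minors are matroids $M/C\backslash D$ with $C,D$ disjoint; a minor is finite if its ground set is finite. A matroid is tame if every intersection of a circuit with a cocircuit is finite. A partial field is a pair $(R,S)$ where $R$ is a ring and $S$ is a subgroup of the group of units of $R$ under multiplication with $-1\in S$. An $(R,S)$-painting of a matroid $M$ is a choice of a function $c_o\colon o\to S$ for each circuit $o$ of $M$ and a function $d_b\colon b\to S$ for each cocircuit $b$ of $M$ such that for every circuit $o$ and cocircuit $b$ we have $\sum_{e\in o\cap b}c_o(e)d_b(e)=0$ in $R$ (which includes the requirement that only finitely many summands are nonzero). $M$ is $(R,S)$-paintable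 if it has an $(R,S)$-painting. *)

theory Defs
  imports "HOL-Algebra.Ring"
begin

section \<open>Infinite matroids\<close>

record 'a set_system =
  ground :: "'a set"
  indep :: "'a set set"

definition is_maximal :: "'a set set \<Rightarrow> 'a set \<Rightarrow> bool" where
  "is_maximal F X \<longleftrightarrow> X \<in> F \<and> (\<forall>Y\<in>F. X \<subseteq> Y \<longrightarrow> Y = X)"

definition is_minimal :: "'a set set \<Rightarrow> 'a set \<Rightarrow> bool" where
  "is_minimal F X \<longleftrightarrow> X \<in> F \<and> (\<forall>Y\<in>F. Y \<subseteq> X \<longrightarrow> Y = X)"

locale matroid =
  fixes M :: "'a set_system"
  assumes indep_subset_ground: "I \<in> indep M \<Longrightarrow> I \<subseteq> ground M"
    and I1: "{} \<in> indep M"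
    and I2: "I \<in> indep M \<Longrightarrow> J \<subseteq> I \<Longrightarrow> J \<in> indep M"
    and I3: "I \<in> indep M \<Longrightarrow> \<not> is_maximal (indep M) I \<Longrightarrow> is_maximal (indep M) I' \<Longrightarrow>
               \<exists>x \<in> I' - I. insert x I \<in> indep M"
    and IM: "I \<in> indep M \<Longrightarrow> I \<subseteq> X \<Longrightarrow> X \<subseteq> ground M \<Longrightarrow>
               \<exists>B. is_maximal {I' \<in> indep M. I \<subseteq> I' \<and> I' \<subseteq> X} B"

definition bases :: "'a set_system \<Rightarrow> 'a set set" where
  "bases M = {B. is_maximal (indep M) B}"

definition circuits :: "'a set_system \<Rightarrow> 'a set set" where
  "circuits M = {C. is_minimal (Pow (ground M) - indep M) C}"

text \<open>The dual is determined by its bases, the complements of the bases of \<open>M\<close>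
  (see \<open>bases_dual\<close> below); its independent sets are the subsets of these.\<close>

definition dual :: "'a set_system \<Rightarrow> 'a set_system" where
  "dual M = \<lparr>ground = ground M, indep = {I. \<exists>B \<in> bases M. I \<subseteq> ground M - B}\<rparr>"

definition cocircuits :: "'a set_system \<Rightarrow> 'a set set" where
  "cocircuits M = circuits (dual M)"

definition deletion :: "'a set_system \<Rightarrow> 'a set \<Rightarrow> 'a set_system" where
  "deletion M D = \<lparr>ground = ground M - D, indep = {I \<in> indep M. I \<inter> D = {}}\<rparr>"

definition contraction :: "'a set_system \<Rightarrow> 'a set \<Rightarrow> 'a set_system" where
  "contraction M C = dual (deletion (dual M) C)"

definition is_minor :: "'a set_system \<Rightarrow> 'a set_system \<Rightarrow> bool" where
  "is_minor N M \<longleftrightarrow> (\<exists>C D. C \<subseteq> ground M \<and> D \<subseteq> ground M \<and> C \<inter> D = {} \<and>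
     N = deletion (contraction M C) D)"

definition finite_minor :: "'a set_system \<Rightarrow> 'a set_system \<Rightarrow> bool" where
  "finite_minor N M \<longleftrightarrow> is_minor N M \<and> finite (ground N)"

definition tame :: "'a set_system \<Rightarrow> bool" where
  "tame M \<longleftrightarrow> (\<forall>C \<in> circuits M. \<forall>B \<in> cocircuits M. finite (C \<inter> B))"

lemma (in matroid) bases_dual: "bases (dual M) = (\<lambda>B. ground M - B) ` bases M"
proof -
  have sub: "B \<subseteq> ground M" if "B \<in> bases M" for B
    using that indep_subset_ground by (auto simp: bases_def is_maximal_def)
  have antichain: "B = B'" if "B \<in> bases M" "B' \<in> bases M" "B' \<subseteq> B" for B B'
    using that by (auto simp: bases_def is_maximal_def)
  show ?thesis
  proof (intro equalityI subsetI)
    fix X assume "X \<in> bases (dual M)"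
    then show "X \<in> (\<lambda>B. ground M - B) ` bases M"
      unfolding bases_def[of "dual M"] is_maximal_def unfolding dual_def by auto
  next
    fix X assume "X \<in> (\<lambda>B. ground M - B) ` bases M"
    then obtain B where B: "B \<in> bases M" "X = ground M - B" by blast
    have "Y = X" if Y: "B' \<in> bases M" "Y \<subseteq> ground M - B'" "X \<subseteq> Y" for Y B'
    proof -
      have "B' \<subseteq> B" using Y B(2) sub[OF Y(1)] by blast
      then have "B = B'" using antichain B(1) Y(1) by blast
      then show ?thesis using Y B(2) by blast
    qed
    then show "X \<in> bases (dual M)"
      using B unfolding bases_def[of "dual M"] is_maximal_def unfolding dual_def by auto
  qed
qed

section \<open>Partial fields and paintings\<close>

text \<open>Rings are unital and not assumed commutative.\<close>

definition partial_field :: "('r, 'm) ring_scheme \<Rightarrow> 'r set \<Rightarrow> bool" where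
  "partial_field R S \<longleftrightarrow> ring R \<and> subgroup S (units_of R) \<and> \<ominus>\<^bsub>R\<^esub> \<one>\<^bsub>R\<^esub> \<in> S"

text \<open>The functions attached to a circuit or cocircuit are total; only their values on
  that circuit or cocircuit matter. The sum is taken over the support of the summands, since
  \<^const>\<open>finsum\<close> has a junk value on infinite index sets.\<close>

definition painting ::
  "('r, 'm) ring_scheme \<Rightarrow> 'r set \<Rightarrow> 'a set_system \<Rightarrow>
     ('a set \<Rightarrow> 'a \<Rightarrow> 'r) \<Rightarrow> ('a set \<Rightarrow> 'a \<Rightarrow> 'r) \<Rightarrow> bool" where
  "painting R S M c d \<longleftrightarrow>
     (\<forall>C \<in> circuits M. c C \<in> C \<rightarrow> S) \<and>
     (\<forall>B \<in> cocircuits M. d B \<in> B \<rightarrow> S) \<and>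
     (\<forall>C \<in> circuits M. \<forall>B \<in> cocircuits M.
        finite {e \<in> C \<inter> B. c C e \<otimes>\<^bsub>R\<^esub> d B e \<noteq> \<zero>\<^bsub>R\<^esub>} \<and>
        (\<Oplus>\<^bsub>R\<^esub>e \<in> {e \<in> C \<inter> B. c C e \<otimes>\<^bsub>R\<^esub> d B e \<noteq> \<zero>\<^bsub>R\<^esub>}. c C e \<otimes>\<^bsub>R\<^esub> d B e) = \<zero>\<^bsub>R\<^esub>)"

definition paintable :: "('r, 'm) ring_scheme \<Rightarrow> 'r set \<Rightarrow> 'a set_system \<Rightarrow> bool" where
  "paintable R S M \<longleftrightarrow> (\<exists>c d. painting R S M c d)"

end

theory Submission
  imports Defs "HOL-Analysis.Function_Topology"
begin

text \<open>If \<open>M\<close> is painted, restricting the colours along circuits \<open>o \<subseteq> o' \<subseteq> o \<union> C\<close> and cocircuits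
  \<open>b \<subseteq> b' \<subseteq> b \<union> D\<close> paints \<open>M/C\D\<close>, because \<open>o' \<inter> b' = o \<inter> b\<close>. Conversely, since \<open>S\<close> is
  finite and \<open>M\<close> is tame, being a painting is a family of clopen conditions in a compact product
  space, so only finitely many circuits \<open>\<O>\<close> and cocircuits \<open>\<B>\<close> need to be painted at once. Let
  \<open>F = \<Union>\<O> \<inter> \<Union>\<B>\<close>, a finite set. For every \<open>o \<in> \<O>\<close> and all \<open>e \<noteq> f\<close> in \<open>o \<inter> F\<close> add to \<open>\<B>\<close> a
  cocircuit that meets \<open>o\<close> in exactly \<open>{e, f}\<close>, and enlarge \<open>\<O>\<close> dually. Contracting the elements
  of the new \<open>\<Union>\<O>\<close> outside the new \<open>\<Union>\<B>\<close> and deleting the complement of \<open>\<Union>\<O>\<close> leaves a finite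
  minor. A circuit of this minor inside \<open>o\<close> that uses one element of \<open>o \<inter> F\<close> uses all of them, by
  orthogonality to the added cocircuits, so a painting of the minor colours \<open>\<O>\<close> and \<open>\<B>\<close>.\<close>

section \<open>Bases, duals and deletions\<close>

context matroid
begin

lemma base_indep: "B \<in> bases M \<Longrightarrow> B \<in> indep M"
  by (simp add: bases_def is_maximal_def)

lemma base_subset_ground: "B \<in> bases M \<Longrightarrow> B \<subseteq> ground M"
  by (simp add: base_indep indep_subset_ground)

lemma base_maximal: "B \<in> bases M \<Longrightarrow> I \<in> indep M \<Longrightarrow> B \<subseteq> I \<Longrightarrow> I = B"
  by (simp add: bases_def is_maximal_def)

lemma base_exchange:
  assumes "I \<in> indep M" "I \<notin> bases M" "B \<in> bases M"
  obtains x where "x \<in> B" "x \<notin> I" "insert x I \<in> indep M"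
  using I3[of I B] assms by (auto simp: bases_def)

lemma maximal_within:
  assumes "I \<in> indep M" "I \<subseteq> X" "X \<subseteq> ground M"
  obtains J where "J \<in> indep M" "I \<subseteq> J" "J \<subseteq> X"
    "\<forall>x\<in>X. insert x J \<in> indep M \<longrightarrow> x \<in> J"
proof -
  obtain J where J: "is_maximal {I' \<in> indep M. I \<subseteq> I' \<and> I' \<subseteq> X} J"
    using IM[OF assms] by blast
  show thesis
  proof (rule that[of J])
    show "\<forall>x\<in>X. insert x J \<in> indep M \<longrightarrow> x \<in> J"
      using J unfolding is_maximal_def by blast
  qed (use J in \<open>auto simp: is_maximal_def\<close>)
qed

text \<open>By I3, a set that is maximal independent within \<open>X\<close> must be a base, as
  otherwise some element of \<open>B\<close>, hence of \<open>X\<close>, could be added. The bound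
  \<open>B' \<subseteq> X\<close> is what the exchange arguments below use in place of comparing
  cardinalities.\<close>

lemma extend_to_base:
  assumes I: "I \<in> indep M" and B: "B \<in> bases M" "B \<subseteq> X" and X: "I \<subseteq> X" "X \<subseteq> ground M"
  obtains B' where "B' \<in> bases M" "I \<subseteq> B'" "B' \<subseteq> X"
proof -
  obtain J where J: "J \<in> indep M" "I \<subseteq> J" "J \<subseteq> X"
      "\<forall>x\<in>X. insert x J \<in> indep M \<longrightarrow> x \<in> J"
    using maximal_within[OF I X] by blast
  have "J \<in> bases M"
  proof (rule ccontr)
    assume "J \<notin> bases M"
    from base_exchange[OF J(1) this B(1)] J(4) B(2) show False by blast
  qed
  with J that show thesis by blast
qed

lemma base_exists: obtains B where "B \<in> bases M"
proof -
  obtain B where B: "is_maximal {I' \<in> indep M. {} \<subseteq> I' \<and> I' \<subseteq> ground M} B"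
    using IM[OF I1, of "ground M"] by blast
  then have "B \<in> bases M"
    using indep_subset_ground by (auto simp: bases_def is_maximal_def)
  then show thesis by (rule that)
qed

lemma indep_extend_to_base:
  assumes "I \<in> indep M"
  obtains B where "B \<in> bases M" "I \<subseteq> B"
proof -
  obtain B where "B \<in> bases M" by (rule base_exists)
  from extend_to_base[OF assms this base_subset_ground[OF this] indep_subset_ground[OF assms]]
  show thesis using that by blast
qed

lemma ground_dual [simp]: "ground (dual M) = ground M"
  by (simp add: dual_def)

lemma indep_dual_iff: "I \<in> indep (dual M) \<longleftrightarrow> (\<exists>B\<in>bases M. I \<subseteq> ground M - B)"
  by (simp add: dual_def)

section \<open>The matroid axioms for the dual\<close>

lemma matroid_dual: "matroid (dual M)"
proof
  show "I \<subseteq> ground (dual M)" if "I \<in> indep (dual M)" for I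
    using that by (auto simp: indep_dual_iff)
  show "{} \<in> indep (dual M)"
    using base_exists by (auto simp: indep_dual_iff)
  show "J \<in> indep (dual M)" if "I \<in> indep (dual M)" "J \<subseteq> I" for I J
    using that unfolding indep_dual_iff by blast
next
  fix I I'
  assume I: "I \<in> indep (dual M)" "\<not> is_maximal (indep (dual M)) I"
    and I': "is_maximal (indep (dual M)) I'"
  from I' have "I' \<in> bases (dual M)" by (simp add: bases_def)
  then obtain B' where B': "B' \<in> bases M" "I' = ground M - B'"
    unfolding bases_dual by blast
  from I obtain J where "J \<in> indep (dual M)" "I \<subset> J"
    unfolding is_maximal_def by blast
  \<comment> \<open>\<open>y\<close> witnesses that \<open>I\<close> is not maximal:
    \<open>insert y I\<close> misses the base \<open>B\<^sub>1\<close>.\<close>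
  then obtain y B\<^sub>1 where y: "y \<notin> I" "y \<in> ground M" and B\<^sub>1: "B\<^sub>1 \<in> bases M" "y \<notin> B\<^sub>1" "I \<inter> B\<^sub>1 = {}"
    and I_ground: "I \<subseteq> ground M"
    unfolding indep_dual_iff by blast
  show "\<exists>x\<in>I' - I. insert x I \<in> indep (dual M)"
  proof (rule ccontr)
    assume none: "\<not> ?thesis"
    have "B' - I \<in> indep M" using I2[OF base_indep[OF B'(1)]] by blast
    then obtain K where K: "K \<in> bases M" "B' - I \<subseteq> K" "K \<subseteq> ground M - I"
      using extend_to_base[of "B' - I" B\<^sub>1 "ground M - I"] B\<^sub>1 base_subset_ground[OF B\<^sub>1(1)]
        base_subset_ground[OF B'(1)] by blast
    \<comment> \<open>An element \<open>x\<close> outside \<open>I\<close> and \<open>K\<close> is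
      outside \<open>B'\<close>, since \<open>B' - I \<subseteq> K\<close>, so it lies in
      \<open>I'\<close>. As \<open>insert x I\<close> misses the base \<open>K\<close>, it would be
      the element sought. Hence \<open>K\<close> contains \<open>B\<^sub>1\<close> together with
      \<open>y\<close>, against maximality of \<open>B\<^sub>1\<close>.\<close>
    have "ground M - I \<subseteq> K"
    proof
      fix x assume x: "x \<in> ground M - I"
      show "x \<in> K"
      proof (rule ccontr)
        assume "x \<notin> K"
        then have "x \<in> I' - I" using x K B' by blast
        moreover have "insert x I \<in> indep (dual M)"
          using K x \<open>x \<notin> K\<close> I_ground unfolding indep_dual_iff by blast
        ultimately show False using none by blast
      qed
    qed
    then have "B\<^sub>1 \<subseteq> K" "y \<in> K"
      using B\<^sub>1 base_subset_ground[OF B\<^sub>1(1)] y by blast+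
    then show False
      using base_maximal[OF B\<^sub>1(1) base_indep[OF K(1)]] B\<^sub>1(2) by blast
  qed
next
  fix I X
  assume I: "I \<in> indep (dual M)" "I \<subseteq> X" "X \<subseteq> ground (dual M)"
  then obtain B where B: "B \<in> bases M" "I \<subseteq> ground M - B"
    unfolding indep_dual_iff by blast
  have X: "X \<subseteq> ground M" using I(3) by simp
  \<comment> \<open>The maximal set sought is \<open>X - K\<close>, where the base \<open>K\<close>
    avoids \<open>I\<close> and contains a maximal independent set \<open>K\<^sub>0\<close> of the
    complement of \<open>X\<close>, so that \<open>K\<close> uses as little of \<open>X\<close> as
    possible.\<close>
  obtain K\<^sub>0 where K\<^sub>0: "K\<^sub>0 \<in> indep M" "K\<^sub>0 \<subseteq> ground M - X"
      "\<forall>x\<in>ground M - X. insert x K\<^sub>0 \<in> indep M \<longrightarrow> x \<in> K\<^sub>0"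
    using maximal_within[OF I1 empty_subsetI Diff_subset] by metis
  obtain K where K: "K \<in> bases M" "K\<^sub>0 \<subseteq> K" "K \<subseteq> ground M - I"
    using extend_to_base[OF K\<^sub>0(1) B(1), of "ground M - I"] K\<^sub>0(2) B base_subset_ground[OF B(1)] I(2)
    by blast
  have "is_maximal {I' \<in> indep (dual M). I \<subseteq> I' \<and> I' \<subseteq> X} (X - K)"
    unfolding is_maximal_def
  proof (intro conjI ballI impI)
    show "X - K \<in> {I' \<in> indep (dual M). I \<subseteq> I' \<and> I' \<subseteq> X}"
      using K X I(2) unfolding indep_dual_iff by blast
  next
    fix Y assume "Y \<in> {I' \<in> indep (dual M). I \<subseteq> I' \<and> I' \<subseteq> X}" and KY: "X - K \<subseteq> Y"
    then obtain B\<^sub>1 where Y: "Y \<subseteq> X" and B\<^sub>1: "B\<^sub>1 \<in> bases M" "Y \<inter> B\<^sub>1 = {}"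
      unfolding indep_dual_iff by blast
    \<comment> \<open>Exchanging \<open>z\<close> for an element \<open>w\<close> of the base
      \<open>B\<^sub>1\<close>, which misses \<open>Y \<supseteq> X - K\<close>, forces
      \<open>w\<close> outside both \<open>K\<close> and \<open>X\<close>. Then \<open>w\<close>
      could be added to \<open>K\<^sub>0\<close>, which does not contain \<open>z\<close>.\<close>
    have False if z: "z \<in> Y" "z \<in> K" for z
    proof -
      have "K - {z} \<in> indep M" "K - {z} \<notin> bases M"
        using I2[OF base_indep[OF K(1)]] base_maximal[OF _ base_indep[OF K(1)], of "K - {z}"] z(2)
        by blast+
      then obtain w where w: "w \<in> B\<^sub>1" "w \<notin> K - {z}" "insert w (K - {z}) \<in> indep M"
        using base_exchange B\<^sub>1(1) by blast
      then have "w \<notin> K" "w \<notin> X" using B\<^sub>1(2) z KY by blast+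
      moreover have "insert w K\<^sub>0 \<in> indep M"
        using I2[OF w(3)] K(2) K\<^sub>0(2) z Y by blast
      moreover have "w \<in> ground M" using w(1) base_subset_ground[OF B\<^sub>1(1)] by blast
      ultimately show False using K\<^sub>0(3) K(2) by blast
    qed
    then show "Y = X - K" using KY Y by blast
  qed
  then show "\<exists>B. is_maximal {I' \<in> indep (dual M). I \<subseteq> I' \<and> I' \<subseteq> X} B" by blast
qed

lemma dual_dual: "dual (dual M) = M"
proof -
  have "indep (dual (dual M)) = indep M"
  proof (intro equalityI subsetI)
    fix I assume "I \<in> indep (dual (dual M))"
    then obtain B where "B \<in> bases M" "I \<subseteq> ground M - (ground M - B)"
      unfolding matroid.indep_dual_iff[OF matroid_dual] bases_dual by auto
    then show "I \<in> indep M" using I2[OF base_indep] by blast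
  next
    fix I assume "I \<in> indep M"
    then obtain B where B: "B \<in> bases M" "I \<subseteq> B" by (rule indep_extend_to_base)
    then have "I \<subseteq> ground M - (ground M - B)" using base_subset_ground by blast
    with B show "I \<in> indep (dual (dual M))"
      unfolding matroid.indep_dual_iff[OF matroid_dual] bases_dual by auto
  qed
  moreover have "ground (dual (dual M)) = ground M" by (simp add: dual_def)
  ultimately show ?thesis by simp
qed

section \<open>The matroid axioms for deletions\<close>

lemma matroid_deletion: "matroid (deletion M D)"
proof -
  let ?X = "ground M - D"
  have ground: "ground (deletion M D) = ?X" by (simp add: deletion_def)
  have indep: "I \<in> indep (deletion M D) \<longleftrightarrow> I \<in> indep M \<and> I \<subseteq> ?X" for I
    using indep_subset_ground by (auto simp: deletion_def)
  show ?thesis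
  proof
    show "I \<subseteq> ground (deletion M D)" if "I \<in> indep (deletion M D)" for I
      using that by (simp add: ground indep)
    show "{} \<in> indep (deletion M D)" by (simp add: indep I1)
    show "J \<in> indep (deletion M D)" if "I \<in> indep (deletion M D)" "J \<subseteq> I" for I J
      using that I2 by (auto simp: indep)
    show "\<exists>B. is_maximal {I' \<in> indep (deletion M D). I \<subseteq> I' \<and> I' \<subseteq> X} B"
      if "I \<in> indep (deletion M D)" "I \<subseteq> X" "X \<subseteq> ground (deletion M D)" for I X
    proof -
      have "{I' \<in> indep (deletion M D). I \<subseteq> I' \<and> I' \<subseteq> X} = {I' \<in> indep M. I \<subseteq> I' \<and> I' \<subseteq> X}"
        using that(3) by (auto simp: indep ground)
      moreover have "I \<in> indep M" "X \<subseteq> ground M" using that by (auto simp: indep ground)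
      ultimately show ?thesis using IM[of I X] that(2) by simp
    qed
  next
    fix I I'
    assume I: "I \<in> indep (deletion M D)" "\<not> is_maximal (indep (deletion M D)) I"
      and I': "is_maximal (indep (deletion M D)) I'"
    from I obtain J where "J \<in> indep (deletion M D)" "I \<subset> J"
      unfolding is_maximal_def by blast
    then obtain y where "y \<in> J" and J: "J \<in> indep M" "J \<subseteq> ?X" "I \<subseteq> J" and y: "y \<notin> I"
      unfolding indep by blast
    then have y: "y \<notin> I" "y \<in> ?X" "insert y I \<in> indep M"
      using I2[OF J(1), of "insert y I"] by blast+
    have I'_indep: "I' \<in> indep M" "I' \<subseteq> ?X" using I' by (auto simp: indep is_maximal_def)
    have I'_max: "x \<in> I'" if "x \<in> ?X" "insert x I' \<in> indep M" for x
    proof -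
      have "insert x I' \<in> indep (deletion M D)" using that I'_indep by (simp add: indep)
      then have "insert x I' = I'" using I' unfolding is_maximal_def by blast
      then show ?thesis by blast
    qed
    obtain B' where B': "B' \<in> bases M" "I' \<subseteq> B'"
      using I'_indep(1) by (rule indep_extend_to_base)
    \<comment> \<open>By maximality of \<open>I'\<close> within \<open>?X\<close>, the base
      \<open>B'\<close> extends it only by elements of \<open>D\<close>.\<close>
    have B'X: "x \<in> I'" if "x \<in> B'" "x \<in> ?X" for x
      using I'_max[OF that(2)] I2[OF base_indep[OF B'(1)], of "insert x I'"] that(1) B'(2) by blast
    have I_indep: "I \<in> indep M" "I \<subseteq> ?X" using I by (auto simp: indep)
    show "\<exists>x\<in>I' - I. insert x I \<in> indep (deletion M D)"
    proof (rule ccontr)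
      assume none: "\<not> ?thesis"
      obtain K where K: "K \<in> bases M" "I \<subseteq> K" "K \<subseteq> I \<union> B'"
        using extend_to_base[OF I_indep(1) B'(1), of "I \<union> B'"] I_indep base_subset_ground[OF B'(1)]
        by blast
      \<comment> \<open>Inside \<open>?X\<close> the base \<open>K\<close> is no larger than
        \<open>I\<close>: a further element would come from \<open>B'\<close>, hence from
        \<open>I'\<close>, and would be the exchange element assumed not to exist.\<close>
      have KX: "x \<in> I" if "x \<in> K" "x \<in> ?X" for x
      proof (rule ccontr)
        assume "x \<notin> I"
        then have "x \<in> I' - I" using that K B'X by blast
        moreover have "insert x I \<in> indep (deletion M D)"
          using I2[OF base_indep[OF K(1)], of "insert x I"] that K(2) I_indep by (simp add: indep)
        ultimately show False using none by blast
      qed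
      \<comment> \<open>Bringing in \<open>y\<close> must push some \<open>w\<close> out of
        \<open>K\<close>, and \<open>w\<close> is an element of \<open>B'\<close> outside
        \<open>?X\<close>. Refilling \<open>B' - {w}\<close> from \<open>L\<close> yields
        \<open>z\<close> outside \<open>B'\<close>, so \<open>z\<close> is \<open>y\<close> or lies
        in \<open>I\<close>. Thus \<open>z\<close> is in \<open>?X\<close>, and adding it to
        \<open>I'\<close> contradicts maximality.\<close>
      obtain L where L: "L \<in> bases M" "insert y I \<subseteq> L" "L \<subseteq> insert y K"
        using extend_to_base[OF y(3) K(1), of "insert y K"] K y base_subset_ground[OF K(1)] by blast
      have "y \<notin> K" using KX y by blast
      then obtain w where w: "w \<in> K" "w \<notin> L"
        using base_maximal[OF K(1) base_indep[OF L(1)]] L(2) by blast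
      have "w \<notin> I" using w L by blast
      then have w': "w \<in> B'" "w \<notin> ?X" using w KX K by blast+
      have "B' - {w} \<in> indep M" "B' - {w} \<notin> bases M"
        using I2[OF base_indep[OF B'(1)]] base_maximal[OF _ base_indep[OF B'(1)], of "B' - {w}"] w'
        by blast+
      then obtain z where z: "z \<in> L" "z \<notin> B' - {w}" "insert z (B' - {w}) \<in> indep M"
        using base_exchange L(1) by blast
      have "z \<notin> B'" using z w by blast
      then have "z \<in> ?X" using z L K I_indep y by blast
      moreover have "insert z I' \<in> indep M"
        using I2[OF z(3)] B'(2) w'(2) I'_indep(2) by blast
      ultimately show False using I'_max \<open>z \<notin> B'\<close> B'(2) by blast
    qed
  qed
qed

section \<open>Orthogonality of circuits and cocircuits\<close>

lemma circuit_subset_ground: "C \<in> circuits M \<Longrightarrow> C \<subseteq> ground M"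
  by (auto simp: circuits_def is_minimal_def)

lemma circuit_dependent: "C \<in> circuits M \<Longrightarrow> C \<notin> indep M"
  by (auto simp: circuits_def is_minimal_def)

lemma circuit_minimal: "C \<in> circuits M \<Longrightarrow> C' \<in> circuits M \<Longrightarrow> C' \<subseteq> C \<Longrightarrow> C' = C"
  by (auto simp: circuits_def is_minimal_def)

lemma circuit_proper_subset_indep: "C \<in> circuits M \<Longrightarrow> X \<subset> C \<Longrightarrow> X \<in> indep M"
  unfolding circuits_def is_minimal_def by blast

lemma circuitI:
  assumes "C \<subseteq> ground M" "C \<notin> indep M" "\<And>x. x \<in> C \<Longrightarrow> C - {x} \<in> indep M"
  shows "C \<in> circuits M"
  unfolding circuits_def is_minimal_def
proof (intro CollectI conjI ballI impI)
  fix Y assume Y: "Y \<in> Pow (ground M) - indep M" "Y \<subseteq> C"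
  show "Y = C"
  proof (rule ccontr)
    assume "Y \<noteq> C"
    then obtain x where "x \<in> C" "Y \<subseteq> C - {x}" using Y by blast
    then show False using I2[OF assms(3)] Y by blast
  qed
qed (use assms in auto)

lemma cocircuit_eq_circuit_dual: "cocircuits M = circuits (dual M)"
  by (simp add: cocircuits_def)

lemma cocircuits_dual: "cocircuits (dual M) = circuits M"
  by (simp add: cocircuits_def dual_dual)

lemma cocircuit_meets_base: "D \<in> cocircuits M \<Longrightarrow> B \<in> bases M \<Longrightarrow> D \<inter> B \<noteq> {}"
  unfolding cocircuit_eq_circuit_dual circuits_def is_minimal_def
  by (auto simp: indep_dual_iff)

text \<open>Suppose they met only in \<open>e\<close>. Extend \<open>C - {e}\<close> to a maximal
  independent set \<open>I\<close> avoiding \<open>D\<close>; it is not a base because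
  \<open>D\<close> meets every base. Minimality of \<open>D\<close> gives a base meeting
  \<open>D\<close> at most in \<open>e\<close>, so exchange can only add \<open>e\<close> to
  \<open>I\<close>, and \<open>C\<close> would be independent.\<close>

lemma circuit_inter_cocircuit_not_singleton:
  assumes C: "C \<in> circuits M" and D: "D \<in> cocircuits M"
  shows "C \<inter> D \<noteq> {e}"
proof
  assume e: "C \<inter> D = {e}"
  have "D - {e} \<in> indep (dual M)"
    using matroid.circuit_proper_subset_indep[OF matroid_dual] D e
    unfolding cocircuit_eq_circuit_dual by blast
  then obtain B where B: "B \<in> bases M" "(D - {e}) \<inter> B = {}"
    unfolding indep_dual_iff by blast
  have "C - {e} \<in> indep M"
    using circuit_proper_subset_indep[OF C] e by blast
  moreover have "C - {e} \<subseteq> ground M - D"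
    using circuit_subset_ground[OF C] e by blast
  ultimately obtain I where I: "I \<in> indep M" "C - {e} \<subseteq> I" "I \<subseteq> ground M - D"
      "\<forall>x\<in>ground M - D. insert x I \<in> indep M \<longrightarrow> x \<in> I"
    using maximal_within[of "C - {e}" "ground M - D"] by blast
  have "I \<notin> bases M" using cocircuit_meets_base[OF D] I(3) by blast
  then obtain z where z: "z \<in> B" "z \<notin> I" "insert z I \<in> indep M"
    using base_exchange[OF I(1) _ B(1)] by blast
  then have "z = e" using I(4) B base_subset_ground[OF B(1)] by blast
  then have "C \<subseteq> insert z I" using I(2) by blast
  then show False using I2[OF z(3)] circuit_dependent[OF C] by blast
qed

section \<open>Fundamental circuits and cocircuits\<close>

lemma fundamental_circuit:
  assumes B: "B \<in> bases M" and x: "x \<in> ground M" "x \<notin> B"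
  shows "{y \<in> insert x B. insert x B - {y} \<in> indep M} \<in> circuits M" (is "?C \<in> _")
proof (rule circuitI)
  show "?C \<subseteq> ground M" using x base_subset_ground[OF B] by blast
  show "?C - {y} \<in> indep M" if "y \<in> ?C" for y
  proof (rule I2)
    show "insert x B - {y} \<in> indep M" using that by blast
  qed blast
  \<comment> \<open>If \<open>?C\<close> were independent, a base \<open>K\<close> between
    \<open>?C\<close> and \<open>insert x B\<close> would omit some \<open>y \<in> B\<close>.
    Exchange from \<open>K\<close> into \<open>B - {y}\<close> can only bring in \<open>x\<close>,
    which shows \<open>y \<in> ?C \<subseteq> K\<close>.\<close>
  have xC: "x \<in> ?C" using base_indep[OF B] x by simp
  show "?C \<notin> indep M"
  proof
    assume "?C \<in> indep M"
    then obtain K where K: "K \<in> bases M" "?C \<subseteq> K" "K \<subseteq> insert x B"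
      using extend_to_base[of ?C B "insert x B"] B x base_subset_ground[OF B] by blast
    have "\<not> B \<subseteq> K"
      using base_maximal[OF B base_indep[OF K(1)]] xC K(2) x by blast
    then obtain y where y: "y \<in> B" "y \<notin> K" by blast
    have "B - {y} \<in> indep M" "B - {y} \<notin> bases M"
      using I2[OF base_indep[OF B]] base_maximal[OF _ base_indep[OF B], of "B - {y}"] y by blast+
    then obtain z where z: "z \<in> K" "z \<notin> B - {y}" "insert z (B - {y}) \<in> indep M"
      using base_exchange K(1) by blast
    then have "z = x" using K(3) y by blast
    moreover have "insert x (B - {y}) = insert x B - {y}" using y x by blast
    ultimately have "y \<in> ?C" using z y by auto
    then show False using y K by blast
  qed
qed

text \<open>Infinite sets rule out shrinking \<open>X\<close> step by step. Instead a maximal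
  independent \<open>I \<subseteq> X\<close> is extended to a base, and the fundamental circuit of
  some \<open>x \<in> X - I\<close> stays in \<open>X\<close>: removing an element outside
  \<open>X\<close> leaves the dependent set \<open>insert x I\<close> in place.\<close>

lemma dependent_contains_circuit:
  assumes X: "X \<subseteq> ground M" "X \<notin> indep M"
  obtains C where "C \<in> circuits M" "C \<subseteq> X"
proof -
  obtain I where I: "I \<in> indep M" "I \<subseteq> X" "\<forall>x\<in>X. insert x I \<in> indep M \<longrightarrow> x \<in> I"
    using maximal_within[OF I1 empty_subsetI X(1)] by metis
  have "I \<noteq> X" using I(1) X(2) by metis
  then obtain x where x: "x \<in> X" "x \<notin> I" using I(2) by blast
  obtain B where B: "B \<in> bases M" "I \<subseteq> B" using I(1) by (rule indep_extend_to_base)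
  have dep: "insert x I \<notin> indep M" using x I(3) by blast
  then have xB: "x \<notin> B" using I2[OF base_indep[OF B(1)], of "insert x I"] B(2) by blast
  have "{y \<in> insert x B. insert x B - {y} \<in> indep M} \<subseteq> X"
  proof
    fix y assume y: "y \<in> {y \<in> insert x B. insert x B - {y} \<in> indep M}"
    show "y \<in> X"
    proof (rule ccontr)
      assume "y \<notin> X"
      then have "insert x I \<subseteq> insert x B - {y}" using x I(2) B(2) by blast
      then show False using I2 y dep by blast
    qed
  qed
  with fundamental_circuit[OF B(1) _ xB] x X that show thesis by blast
qed

text \<open>The elements that can replace \<open>e\<close> in \<open>B\<close> meet every base, by
  exchange into \<open>B - {e}\<close>. After dropping any one of them, \<open>f\<close>, the rest
  misses the base \<open>insert f (B - {e})\<close>.\<close>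

lemma fundamental_cocircuit:
  assumes B: "B \<in> bases M" and e: "e \<in> B"
  shows "{f \<in> ground M. f \<notin> B - {e} \<and> insert f (B - {e}) \<in> indep M} \<in> cocircuits M" (is "?D \<in> _")
  unfolding cocircuit_eq_circuit_dual
proof (rule matroid.circuitI[OF matroid_dual])
  have Be: "B - {e} \<in> indep M" "B - {e} \<notin> bases M"
    using I2[OF base_indep[OF B]] base_maximal[OF _ base_indep[OF B], of "B - {e}"] e by blast+
  show "?D \<subseteq> ground (dual M)" by auto
  show "?D \<notin> indep (dual M)"
  proof
    assume "?D \<in> indep (dual M)"
    then obtain B' where B': "B' \<in> bases M" "?D \<inter> B' = {}" unfolding indep_dual_iff by blast
    from base_exchange[OF Be B'(1)] obtain z
      where "z \<in> B'" "z \<notin> B - {e}" "insert z (B - {e}) \<in> indep M" .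
    then show False using B'(2) base_subset_ground[OF B'(1)] by blast
  qed
  show "?D - {f} \<in> indep (dual M)" if f: "f \<in> ?D" for f
  proof -
    let ?B = "insert f (B - {e})"
    \<comment> \<open>Only \<open>e\<close> could be added from \<open>B\<close>, and that would
      make the proper superset \<open>insert f B\<close> of \<open>B\<close> independent.\<close>
    have base: "?B \<in> bases M"
    proof (rule ccontr)
      assume "?B \<notin> bases M"
      moreover have "?B \<in> indep M" using f by blast
      ultimately obtain z where z: "z \<in> B" "z \<notin> ?B" "insert z ?B \<in> indep M"
        using base_exchange[OF _ _ B] by blast
      then have "z = e" by blast
      then have "insert z ?B = insert f B" "f \<notin> B" using z f by blast+
      with z(3) have "insert f B \<in> indep M" "f \<notin> B" by simp_all
      then show False using base_maximal[OF B, of "insert f B"] by blast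
    qed
    show ?thesis unfolding indep_dual_iff
    proof (intro bexI[OF _ base] subsetI)
      fix g assume "g \<in> ?D - {f}"
      then show "g \<in> ground M - ?B" by auto
    qed
  qed
qed

section \<open>Minty's colouring lemma and its consequences\<close>

text \<open>Take a maximal independent \<open>I \<subseteq> P\<close>. If \<open>e\<close> depends
  on \<open>I\<close>, a circuit in \<open>insert e I\<close> must use \<open>e\<close>. Otherwise a
  base containing \<open>insert e I\<close> has a fundamental cocircuit of \<open>e\<close>, and it
  misses \<open>P\<close>, since an element of \<open>P\<close> replacing \<open>e\<close> could
  also be added to \<open>I\<close>.\<close>

lemma minty:
  assumes P: "P \<subseteq> ground M" and e: "e \<in> ground M" "e \<notin> P"
  shows "(\<exists>C\<in>circuits M. e \<in> C \<and> C \<subseteq> insert e P) \<or> (\<exists>D\<in>cocircuits M. e \<in> D \<and> D \<inter> P = {})"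
proof -
  obtain I where I: "I \<in> indep M" "I \<subseteq> P" "\<forall>x\<in>P. insert x I \<in> indep M \<longrightarrow> x \<in> I"
    using maximal_within[OF I1 empty_subsetI P] by metis
  show ?thesis
  proof (cases "insert e I \<in> indep M")
    case False
    moreover have "insert e I \<subseteq> ground M" using I(2) P e(1) by blast
    ultimately obtain C where C: "C \<in> circuits M" "C \<subseteq> insert e I"
      using dependent_contains_circuit by metis
    have "\<not> C \<subseteq> I" using I2[OF I(1), of C] circuit_dependent[OF C(1)] by blast
    then have "e \<in> C" "C \<subseteq> insert e P" using C(2) I(2) by blast+
    then show ?thesis using C(1) by blast
  next
    case True
    then obtain B where B: "B \<in> bases M" "insert e I \<subseteq> B" by (rule indep_extend_to_base)
    then have eB: "e \<in> B" by blast
    let ?D = "{f \<in> ground M. f \<notin> B - {e} \<and> insert f (B - {e}) \<in> indep M}"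
    have D: "?D \<in> cocircuits M" using fundamental_cocircuit[OF B(1) eB] .
    have "insert e (B - {e}) = B" using eB by blast
    then have "e \<in> ?D" using e(1) base_indep[OF B(1)] by simp
    moreover have False if "f \<in> ?D" "f \<in> P" for f
    proof -
      from that(1) have f: "f \<notin> B - {e}" "insert f (B - {e}) \<in> indep M" by simp_all
      have "insert f I \<subseteq> insert f (B - {e})" using B(2) I(2) e(2) by blast
      then have "insert f I \<in> indep M" by (rule I2[OF f(2)])
      then have "f \<in> I" using I(3) that(2) by blast
      then show False using f(1) e(2) B(2) that(2) by blast
    qed
    ultimately show ?thesis using D by (intro disjI2 bexI[of _ ?D]) auto
  qed
qed

text \<open>Applying \<open>minty\<close> with \<open>P = X - {e}\<close>, the cocircuit alternative
  would meet \<open>X\<close> in exactly \<open>{e}\<close>. This converse to orthogonality lets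
  circuits of minors be found by inspecting cocircuits alone.\<close>

lemma circuit_through_if_orthogonal:
  assumes X: "X \<subseteq> ground M" "e \<in> X"
    and orth: "\<And>D. D \<in> cocircuits M \<Longrightarrow> X \<inter> D \<noteq> {e}"
  obtains C where "C \<in> circuits M" "e \<in> C" "C \<subseteq> X"
proof -
  have "\<not> (e \<in> D \<and> D \<inter> (X - {e}) = {})" if "D \<in> cocircuits M" for D
    using orth[OF that] X(2) by blast
  moreover have "X - {e} \<subseteq> ground M" "e \<in> ground M" "e \<notin> X - {e}" using X by blast+
  note minty[OF this]
  moreover have "insert e (X - {e}) = X" using X(2) by blast
  ultimately show thesis using that by metis
qed

text \<open>By minimality of \<open>C\<close> no circuit fits into \<open>C - {f}\<close>, so
  \<open>minty\<close> with \<open>P = C - {e, f}\<close> yields a cocircuit through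
  \<open>e\<close>. It must contain \<open>f\<close> too, as it cannot meet \<open>C\<close> in one
  element.\<close>

lemma cocircuit_through_pair:
  assumes C: "C \<in> circuits M" and ef: "e \<in> C" "f \<in> C" "e \<noteq> f"
  obtains D where "D \<in> cocircuits M" "C \<inter> D = {e, f}"
proof -
  have "\<not> C' \<subseteq> insert e (C - {e, f})" if C': "C' \<in> circuits M" for C'
  proof
    assume sub: "C' \<subseteq> insert e (C - {e, f})"
    then have "C' = C" using circuit_minimal[OF C C'] ef(1) by blast
    then show False using sub ef by blast
  qed
  then obtain D where D: "D \<in> cocircuits M" "e \<in> D" "D \<inter> (C - {e, f}) = {}"
    using minty[of "C - {e, f}" e] circuit_subset_ground[OF C] ef by blast
  then have "C \<inter> D \<subseteq> {e, f}" "e \<in> C \<inter> D" using ef by blast+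
  then have "C \<inter> D = {e, f}"
    using circuit_inter_cocircuit_not_singleton[OF C D(1), of e] by blast
  with D(1) show thesis by (rule that)
qed

section \<open>Circuits and cocircuits of minors\<close>

lemma circuits_deletion: "circuits (deletion M D) = {C \<in> circuits M. C \<inter> D = {}}"
proof -
  have "Pow (ground (deletion M D)) - indep (deletion M D) =
      {X \<in> Pow (ground M) - indep M. X \<inter> D = {}}"
    by (auto simp: deletion_def)
  moreover have "is_minimal {X \<in> F. X \<inter> D = {}} C \<longleftrightarrow> is_minimal F C \<and> C \<inter> D = {}"
    for F and C :: "'a set"
  proof -
    have "Y \<inter> D = {}" if "C \<inter> D = {}" "Y \<subseteq> C" for Y using that by blast
    then show ?thesis unfolding is_minimal_def Ball_def mem_Collect_eq by metis
  qed
  ultimately show ?thesis by (simp only: circuits_def mem_Collect_eq)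
qed

lemma matroid_contraction: "matroid (contraction M C)"
  unfolding contraction_def
  by (intro matroid.matroid_dual matroid.matroid_deletion matroid_dual)

lemma dual_contraction: "dual (contraction M C) = deletion (dual M) C"
  unfolding contraction_def
  by (intro matroid.dual_dual matroid.matroid_deletion matroid_dual)

lemma dual_deletion: "dual (deletion M D) = contraction (dual M) D"
  by (simp add: contraction_def dual_dual)

lemma cocircuits_contraction: "cocircuits (contraction M C) = {D \<in> cocircuits M. D \<inter> C = {}}"
  by (simp add: cocircuits_def dual_contraction matroid.circuits_deletion[OF matroid_dual])

lemma ground_contraction: "ground (contraction M C) = ground M - C"
  by (simp add: contraction_def deletion_def dual_def)

text \<open>Cocircuits of the contraction are the cocircuits of \<open>M\<close> that miss
  \<open>C\<close>, and these meet \<open>K - C\<close> exactly where they meet \<open>K\<close>. So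
  \<open>K - C\<close> inherits the orthogonality of \<open>K\<close>.\<close>

lemma circuit_contraction_below:
  assumes K: "K \<in> circuits M" and e: "e \<in> K - C"
  obtains K' where "K' \<in> circuits (contraction M C)" "e \<in> K'" "K' \<subseteq> K - C"
proof (rule matroid.circuit_through_if_orthogonal[OF matroid_contraction])
  show "K - C \<subseteq> ground (contraction M C)"
    using circuit_subset_ground[OF K] unfolding ground_contraction by blast
  show "(K - C) \<inter> D \<noteq> {e}" if D: "D \<in> cocircuits (contraction M C)" for D
  proof -
    have "D \<in> cocircuits M" "(K - C) \<inter> D = K \<inter> D" using D unfolding cocircuits_contraction by blast+
    then show ?thesis using circuit_inter_cocircuit_not_singleton[OF K] by simp
  qed
qed (use e that in auto)

lemma circuit_contraction_lift:
  assumes K: "K \<in> circuits (contraction M C)" and C: "C \<subseteq> ground M"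
  obtains K' where "K' \<in> circuits M" "K \<subseteq> K'" "K' \<subseteq> K \<union> C"
proof -
  interpret MC: matroid "contraction M C" by (rule matroid_contraction)
  have sub: "K \<subseteq> ground M - C" using MC.circuit_subset_ground[OF K] by (simp add: ground_contraction)
  have "K \<noteq> {}" using MC.circuit_dependent[OF K] MC.I1 by metis
  then obtain e where e: "e \<in> K" by blast
  have X: "K \<union> C \<subseteq> ground M" "e \<in> K \<union> C" using sub C e by blast+
  \<comment> \<open>Since \<open>e \<notin> C\<close>, such a \<open>D\<close> would miss
    \<open>C\<close>, so it would be a cocircuit of the contraction meeting the circuit
    \<open>K\<close> only in \<open>e\<close>.\<close>
  have "(K \<union> C) \<inter> D \<noteq> {e}" if D: "D \<in> cocircuits M" for D
  proof
    assume eq: "(K \<union> C) \<inter> D = {e}"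
    then have "D \<inter> C = {}" "K \<inter> D = {e}" using e sub by blast+
    then show False
      using D MC.circuit_inter_cocircuit_not_singleton[OF K, of D e]
      unfolding cocircuits_contraction by simp
  qed
  then obtain K' where K': "K' \<in> circuits M" "e \<in> K'" "K' \<subseteq> K \<union> C"
    using circuit_through_if_orthogonal[OF X] by metis
  \<comment> \<open>Nothing so far says that \<open>K'\<close> covers \<open>K\<close>. This follows
    because its trace outside \<open>C\<close> contains a circuit of the contraction inside
    \<open>K\<close>, which minimality identifies with \<open>K\<close>.\<close>
  have "e \<in> K' - C" using K'(2) e sub by blast
  then obtain K'' where K'': "K'' \<in> circuits (contraction M C)" "K'' \<subseteq> K' - C"
    using circuit_contraction_below[OF K'(1)] by metis
  have "K'' \<subseteq> K" using K''(2) K'(3) by blast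
  then have "K'' = K" using MC.circuit_minimal[OF K K''(1)] by simp
  then have "K \<subseteq> K'" using K''(2) by blast
  from K'(1) this K'(3) show thesis by (rule that)
qed

lemma circuit_minor_lift:
  assumes "K \<in> circuits (deletion (contraction M C) D)" and "C \<subseteq> ground M"
  obtains K' where "K' \<in> circuits M" "K \<subseteq> K'" "K' \<subseteq> K \<union> C"
proof -
  have "K \<in> circuits (contraction M C)"
    using assms(1) unfolding matroid.circuits_deletion[OF matroid_contraction] by blast
  from this assms(2) show thesis by (rule circuit_contraction_lift) (rule that)
qed

lemma circuit_minor_below:
  assumes "K \<in> circuits M" "K \<inter> D = {}" "e \<in> K - C"
  obtains K' where "K' \<in> circuits (deletion (contraction M C) D)" "e \<in> K'" "K' \<subseteq> K"
proof -
  obtain K' where K': "K' \<in> circuits (contraction M C)" "e \<in> K'" "K' \<subseteq> K - C"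
    using circuit_contraction_below[OF assms(1,3)] .
  then have "K' \<inter> D = {}" using assms(2) by blast
  with K' show thesis
    using that unfolding matroid.circuits_deletion[OF matroid_contraction] by blast
qed

text \<open>Dualising turns contraction of \<open>C\<close> into deletion and deletion of
  \<open>D\<close> into contraction. Facts about cocircuits of the minor thereby reduce to the
  contraction lemmas for circuits, applied to \<open>deletion (dual M) C\<close>.\<close>

lemma cocircuits_minor:
  "cocircuits (deletion (contraction M C) D) = circuits (contraction (deletion (dual M) C) D)"
  by (simp add: cocircuits_def matroid.dual_deletion[OF matroid_contraction] dual_contraction)

lemma cocircuit_minor_lift:
  assumes "K \<in> cocircuits (deletion (contraction M C) D)" and "D \<subseteq> ground M" and "C \<inter> D = {}"
  obtains K' where "K' \<in> cocircuits M" "K \<subseteq> K'" "K' \<subseteq> K \<union> D"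
proof -
  interpret MC: matroid "deletion (dual M) C"
    by (intro matroid.matroid_deletion matroid_dual)
  have "D \<subseteq> ground (deletion (dual M) C)" using assms by (auto simp: deletion_def dual_def)
  with assms(1) obtain K' where "K' \<in> circuits (deletion (dual M) C)" "K \<subseteq> K'" "K' \<subseteq> K \<union> D"
    unfolding cocircuits_minor by (rule MC.circuit_contraction_lift)
  then show thesis
    using that unfolding matroid.circuits_deletion[OF matroid_dual] cocircuit_eq_circuit_dual by blast
qed

lemma cocircuit_minor_below:
  assumes "K \<in> cocircuits M" "K \<inter> C = {}" "e \<in> K - D"
  obtains K' where "K' \<in> cocircuits (deletion (contraction M C) D)" "e \<in> K'" "K' \<subseteq> K"
proof -
  interpret MC: matroid "deletion (dual M) C"
    by (intro matroid.matroid_deletion matroid_dual)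
  have "K \<in> circuits (deletion (dual M) C)"
    using assms unfolding matroid.circuits_deletion[OF matroid_dual] cocircuit_eq_circuit_dual by blast
  then obtain K' where "K' \<in> circuits (contraction (deletion (dual M) C) D)" "e \<in> K'" "K' \<subseteq> K - D"
    using assms(3) by (rule MC.circuit_contraction_below)
  then show thesis using that unfolding cocircuits_minor by blast
qed

lemma circuit_through_pair:
  assumes "D \<in> cocircuits M" "e \<in> D" "f \<in> D" "e \<noteq> f"
  obtains C where "C \<in> circuits M" "D \<inter> C = {e, f}"
proof -
  have "D \<in> circuits (dual M)" using assms(1) by (simp add: cocircuits_def)
  from matroid.cocircuit_through_pair[OF matroid_dual this assms(2-4)] that show thesis
    unfolding cocircuits_dual by blast
qed

section \<open>A finite minor retaining prescribed intersections\<close>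

text \<open>The inclusions make the intersections of \<open>K'\<close> with \<open>L'\<close> and of
  \<open>K\<close> with \<open>L\<close> coincide, so a painting of \<open>N\<close> settles all
  pairs at once. An empty trace is exempt, because \<open>K\<close> might be contracted, or
  \<open>L\<close> deleted, in its entirety.\<close>

lemma finite_minor_tracing:
  assumes tame: "tame M"
    and \<O>: "finite \<O>" "\<O> \<subseteq> circuits M" and \<B>: "finite \<B>" "\<B> \<subseteq> cocircuits M"
  obtains N where "finite_minor N M"
    "\<forall>K\<in>\<O>. K \<inter> \<Union>\<B> \<noteq> {} \<longrightarrow> (\<exists>K'\<in>circuits N. K \<inter> \<Union>\<B> \<subseteq> K' \<and> K' \<subseteq> K)"
    "\<forall>L\<in>\<B>. L \<inter> \<Union>\<O> \<noteq> {} \<longrightarrow> (\<exists>L'\<in>cocircuits N. L \<inter> \<Union>\<O> \<subseteq> L' \<and> L' \<subseteq> L)"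
proof -
  have fin: "finite (\<Union>\<O>' \<inter> \<Union>\<B>')"
    if "finite \<O>'" "\<O>' \<subseteq> circuits M" "finite \<B>'" "\<B>' \<subseteq> cocircuits M" for \<O>' \<B>'
  proof -
    have "finite (K \<inter> L)" if "K \<in> \<O>'" "L \<in> \<B>'" for K L
      using tame that \<open>\<O>' \<subseteq> circuits M\<close> \<open>\<B>' \<subseteq> cocircuits M\<close> unfolding tame_def by blast
    then have "finite (\<Union>K\<in>\<O>'. \<Union>L\<in>\<B>'. K \<inter> L)"
      by (intro finite_UN_I that(1,3))
    then show ?thesis by (rule rev_finite_subset) auto
  qed
  define F where "F = \<Union>\<O> \<inter> \<Union>\<B>"
  have "finite F" unfolding F_def by (rule fin[OF \<O> \<B>])
  have "\<exists>L\<in>cocircuits M. K \<inter> L = {e, f}" if "K \<in> \<O>" "e \<in> K" "f \<in> K" "e \<noteq> f" for K e f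
  proof -
    have "K \<in> circuits M" using that(1) \<O>(2) by blast
    then show ?thesis by (rule cocircuit_through_pair[OF _ that(2-4)]) (rule bexI)
  qed
  then obtain g where g: "\<And>K e f. K \<in> \<O> \<Longrightarrow> e \<in> K \<Longrightarrow> f \<in> K \<Longrightarrow> e \<noteq> f \<Longrightarrow>
      g K e f \<in> cocircuits M \<and> K \<inter> g K e f = {e, f}" by metis
  have "\<exists>K\<in>circuits M. L \<inter> K = {e, f}" if "L \<in> \<B>" "e \<in> L" "f \<in> L" "e \<noteq> f" for L e f
  proof -
    have "L \<in> cocircuits M" using that(1) \<B>(2) by blast
    then show ?thesis by (rule circuit_through_pair[OF _ that(2-4)]) (rule bexI)
  qed
  then obtain h where h: "\<And>L e f. L \<in> \<B> \<Longrightarrow> e \<in> L \<Longrightarrow> f \<in> L \<Longrightarrow> e \<noteq> f \<Longrightarrow>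
      h L e f \<in> circuits M \<and> L \<inter> h L e f = {e, f}" by metis
  \<comment> \<open>The choice functions \<open>g\<close> and \<open>h\<close> are arbitrary on
    triples that do not give two distinct elements of the set in question; the filters discard
    values that are not cocircuits or circuits.\<close>
  define \<B>' where "\<B>' = \<B> \<union> {L \<in> (\<lambda>(K, e, f). g K e f) ` (\<O> \<times> F \<times> F). L \<in> cocircuits M}"
  define \<O>' where "\<O>' = \<O> \<union> {K \<in> (\<lambda>(L, e, f). h L e f) ` (\<B> \<times> F \<times> F). K \<in> circuits M}"
  have \<B>': "finite \<B>'" "\<B>' \<subseteq> cocircuits M" "\<B> \<subseteq> \<B>'"
    using \<B> \<O>(1) \<open>finite F\<close> unfolding \<B>'_def by auto
  have \<O>': "finite \<O>'" "\<O>' \<subseteq> circuits M" "\<O> \<subseteq> \<O>'"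
    using \<O> \<B>(1) \<open>finite F\<close> unfolding \<O>'_def by auto
  have g\<B>': "g K e f \<in> \<B>'" if "K \<in> \<O>" "e \<in> K \<inter> F" "f \<in> K \<inter> F" "e \<noteq> f" for K e f
    using that g[of K e f] unfolding \<B>'_def by auto
  have h\<O>': "h L e f \<in> \<O>'" if "L \<in> \<B>" "e \<in> L \<inter> F" "f \<in> L \<inter> F" "e \<noteq> f" for L e f
    using that h[of L e f] unfolding \<O>'_def by auto
  define C where "C = \<Union>\<O>' - \<Union>\<B>'"
  define D where "D = ground M - \<Union>\<O>'"
  define N where "N = deletion (contraction M C) D"
  have \<O>'_ground: "\<Union>\<O>' \<subseteq> ground M" using \<O>'(2) circuit_subset_ground by blast
  have CD: "C \<subseteq> ground M" "D \<subseteq> ground M" "C \<inter> D = {}"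
    using \<O>'_ground unfolding C_def D_def by auto
  have "ground N = ground M - C - D"
    unfolding N_def by (simp add: deletion_def ground_contraction)
  then have "ground N = \<Union>\<O>' \<inter> \<Union>\<B>'"
    using \<O>'_ground unfolding C_def D_def by blast
  then have minor: "finite_minor N M"
    using CD fin[OF \<O>'(1,2) \<B>'(1,2)] unfolding finite_minor_def is_minor_def N_def by auto
  interpret N: matroid N
    unfolding N_def by (intro matroid.matroid_deletion matroid_contraction)
  \<comment> \<open>All of \<open>F\<close> survives in \<open>N\<close>. Moreover no member of
    \<open>\<O>'\<close> meets \<open>D\<close> and no member of \<open>\<B>'\<close> meets
    \<open>C\<close>, so each of them contains a circuit or cocircuit of \<open>N\<close> through
    any prescribed element of \<open>F\<close> that it has.\<close>
  have FC: "F \<inter> C = {}" and FD: "F \<inter> D = {}"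
    using \<O>'(3) \<B>'(3) unfolding F_def C_def D_def by auto
  have circuit_below: "\<exists>K'\<in>circuits N. e \<in> K' \<and> K' \<subseteq> K" if "K \<in> \<O>'" "e \<in> K" "e \<in> F" for K e
  proof -
    have "K \<in> circuits M" "K \<inter> D = {}" "e \<in> K - C"
      using that \<O>'(2) FC unfolding D_def by auto
    then show ?thesis unfolding N_def using circuit_minor_below by metis
  qed
  have cocircuit_below: "\<exists>L'\<in>cocircuits N. e \<in> L' \<and> L' \<subseteq> L" if "L \<in> \<B>'" "e \<in> L" "e \<in> F" for L e
  proof -
    have "L \<in> cocircuits M" "L \<inter> C = {}" "e \<in> L - D"
      using that \<B>'(2) FD unfolding C_def by auto
    then show ?thesis unfolding N_def using cocircuit_minor_below by metis
  qed
  show thesis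
  proof (rule that[OF minor]; intro ballI impI)
    fix K assume K: "K \<in> \<O>" "K \<inter> \<Union>\<B> \<noteq> {}"
    have KF: "K \<inter> \<Union>\<B> = K \<inter> F" using K(1) unfolding F_def by blast
    then obtain e where e: "e \<in> K" "e \<in> F" using K by blast
    then obtain K' where K': "K' \<in> circuits N" "e \<in> K'" "K' \<subseteq> K"
      using circuit_below K(1) \<O>'(3) by blast
    have "f \<in> K'" if f: "f \<in> K \<inter> F" for f
    proof (cases "f = e")
      case False
      then have L: "g K e f \<in> \<B>'" "K \<inter> g K e f = {e, f}"
        using g\<B>'[of K e f] g[of K e f] K(1) e f by auto
      \<comment> \<open>\<open>K' \<inter> L'\<close> lies in \<open>{e, f}\<close> and contains
        \<open>e\<close>; orthogonality in \<open>N\<close> forces it to contain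
        \<open>f\<close>.\<close>
      then obtain L' where "L' \<in> cocircuits N" "e \<in> L'" "L' \<subseteq> g K e f"
        using cocircuit_below[OF L(1), of e] e by blast
      then show ?thesis
        using N.circuit_inter_cocircuit_not_singleton[OF K'(1), of L' e] K' L(2) by blast
    qed (use K' in simp)
    with K' KF show "\<exists>K'\<in>circuits N. K \<inter> \<Union>\<B> \<subseteq> K' \<and> K' \<subseteq> K" by blast
  next
    fix L assume L: "L \<in> \<B>" "L \<inter> \<Union>\<O> \<noteq> {}"
    have LF: "L \<inter> \<Union>\<O> = L \<inter> F" using L(1) unfolding F_def by blast
    then obtain e where e: "e \<in> L" "e \<in> F" using L by blast
    then obtain L' where L': "L' \<in> cocircuits N" "e \<in> L'" "L' \<subseteq> L"
      using cocircuit_below L(1) \<B>'(3) by blast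
    have "f \<in> L'" if f: "f \<in> L \<inter> F" for f
    proof (cases "f = e")
      case False
      then have K: "h L e f \<in> \<O>'" "L \<inter> h L e f = {e, f}"
        using h\<O>'[of L e f] h[of L e f] L(1) e f by auto
      then obtain K' where "K' \<in> circuits N" "e \<in> K'" "K' \<subseteq> h L e f"
        using circuit_below[OF K(1), of e] e by blast
      then show ?thesis
        using N.circuit_inter_cocircuit_not_singleton[OF _ L'(1), of K' e] L' K(2) by blast
    qed (use L' in simp)
    with L' LF show "\<exists>L'\<in>cocircuits N. L \<inter> \<Union>\<O> \<subseteq> L' \<and> L' \<subseteq> L" by blast
  qed
qed

end

section \<open>Paintings\<close>

text \<open>With \<open>S\<close> finite and discrete, Tychonoff's theorem makes the space of
  colourings compact. A constraint that reads finitely many coordinates is closed, and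
  satisfiability of finite subfamilies is the finite intersection property.\<close>

lemma local_constraints_compactness:
  fixes P :: "'k \<Rightarrow> ('i \<Rightarrow> 'r) \<Rightarrow> bool"
  assumes "finite S"
    and fin: "\<And>k. k \<in> A \<Longrightarrow> finite (J k)"
    and loc: "\<And>k f g. k \<in> A \<Longrightarrow> range f \<subseteq> S \<Longrightarrow> range g \<subseteq> S \<Longrightarrow>
      (\<And>i. i \<in> J k \<Longrightarrow> f i = g i) \<Longrightarrow> P k f \<Longrightarrow> P k g"
    and sat: "\<And>A'. finite A' \<Longrightarrow> A' \<subseteq> A \<Longrightarrow> \<exists>f. range f \<subseteq> S \<and> (\<forall>k\<in>A'. P k f)"
  shows "\<exists>f. range f \<subseteq> S \<and> (\<forall>k\<in>A. P k f)"
proof -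
  let ?T = "product_topology (\<lambda>_::'i. discrete_topology S) UNIV"
  let ?Z = "\<lambda>k. {f \<in> topspace ?T. P k f}"
  have top: "f \<in> topspace ?T \<longleftrightarrow> range f \<subseteq> S" for f
    by (auto simp: PiE_iff)
  have compact: "compact_space ?T"
    using assms(1) by (simp add: compact_space_product_topology compact_space_discrete_topology)
  have closed: "closedin ?T (?Z k)" if k: "k \<in> A" for k
  proof -
    have "openin ?T (topspace ?T - ?Z k)"
      unfolding openin_product_topology_alt
    proof (intro ballI)
      fix x assume x: "x \<in> topspace ?T - ?Z k"
      \<comment> \<open>Freezing the finitely many coordinates in \<open>J k\<close> gives a basic
        neighbourhood of \<open>x\<close> on which the constraint keeps failing.\<close>
      let ?U = "\<lambda>i. if i \<in> J k then {x i} else S"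
      have "finite {i \<in> UNIV. ?U i \<noteq> topspace (discrete_topology S)}"
        by (rule finite_subset[OF _ fin[OF k]]) auto
      moreover have "\<forall>i\<in>UNIV. openin (discrete_topology S) (?U i)" "x \<in> Pi\<^sub>E UNIV ?U"
        using x by (auto simp: PiE_iff)
      moreover have "y \<in> topspace ?T - ?Z k" if y: "y \<in> Pi\<^sub>E UNIV ?U" for y
      proof -
        have yx: "y i = x i" if "i \<in> J k" for i
          using PiE_mem[OF y, of i] that by simp
        have "y i \<in> S" for i
          using PiE_mem[OF y, of i] x unfolding Diff_iff top by (auto split: if_splits)
        then have "range y \<subseteq> S" by blast
        moreover from x have "range x \<subseteq> S" "\<not> P k x" unfolding Diff_iff mem_Collect_eq top by blast+
        ultimately have "\<not> P k y" using loc[OF k, of y x] yx by blast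
        moreover have "y \<in> topspace ?T" unfolding top by fact
        ultimately show ?thesis by simp
      qed
      then have "Pi\<^sub>E UNIV ?U \<subseteq> topspace ?T - ?Z k" by (rule subsetI)
      ultimately show "\<exists>U. finite {i \<in> UNIV. U i \<noteq> topspace (discrete_topology S)} \<and>
          (\<forall>i\<in>UNIV. openin (discrete_topology S) (U i)) \<and> x \<in> Pi\<^sub>E UNIV U \<and>
          Pi\<^sub>E UNIV U \<subseteq> topspace ?T - ?Z k"
        by (intro exI[of _ ?U] conjI)
    qed
    then show ?thesis unfolding closedin_def by (intro conjI Collect_restrict)
  qed
  \<comment> \<open>Empty \<open>A\<close> is treated apart: the intersection of the empty family is
    the set of all functions, so its members need not have range in \<open>S\<close>.\<close>
  show ?thesis
  proof (cases "A = {}")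
    case True
    then show ?thesis using sat[of "{}"] by auto
  next
    case False
    have "\<Inter>\<F> \<noteq> {}" if \<F>: "finite \<F>" "\<F> \<subseteq> ?Z ` A" for \<F>
    proof -
      obtain A' where A': "A' \<subseteq> A" "finite A'" "\<F> = ?Z ` A'"
        using finite_subset_image[OF \<F>] by blast
      obtain f where f: "range f \<subseteq> S" "\<forall>k\<in>A'. P k f" using sat[OF A'(2,1)] by blast
      then have "f \<in> \<Inter>\<F>" unfolding A'(3) using top[of f] by simp
      then show ?thesis by blast
    qed
    moreover have "\<forall>Z\<in>?Z ` A. closedin ?T Z" using closed by simp
    ultimately have "\<Inter>(?Z ` A) \<noteq> {}"
      using compact[unfolded compact_space_fip, THEN spec[of _ "?Z ` A"]] by simp
    then obtain f where f: "f \<in> \<Inter>(?Z ` A)" by blast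
    have "range f \<subseteq> S" using f False unfolding top[symmetric] by auto
    moreover have "\<forall>k\<in>A. P k f" using f by simp
    ultimately show ?thesis by blast
  qed
qed

section \<open>Paintings of a matroid and of its minors\<close>

lemma painting_circuit_closed: "painting R S M c d \<Longrightarrow> K \<in> circuits M \<Longrightarrow> e \<in> K \<Longrightarrow> c K e \<in> S"
  unfolding painting_def by (elim conjE) (drule (1) bspec, erule (1) funcset_mem)

lemma painting_cocircuit_closed: "painting R S M c d \<Longrightarrow> L \<in> cocircuits M \<Longrightarrow> e \<in> L \<Longrightarrow> d L e \<in> S"
  unfolding painting_def by (elim conjE) (drule (1) bspec, erule (1) funcset_mem)

lemma painting_orthogonal:
  assumes "painting R S M c d" "K \<in> circuits M" "L \<in> cocircuits M"
  shows "finite {e \<in> K \<inter> L. c K e \<otimes>\<^bsub>R\<^esub> d L e \<noteq> \<zero>\<^bsub>R\<^esub>}"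
    and "(\<Oplus>\<^bsub>R\<^esub>e\<in>{e \<in> K \<inter> L. c K e \<otimes>\<^bsub>R\<^esub> d L e \<noteq> \<zero>\<^bsub>R\<^esub>}. c K e \<otimes>\<^bsub>R\<^esub> d L e) = \<zero>\<^bsub>R\<^esub>"
  using assms unfolding painting_def by simp_all

lemma paintable_minor:
  assumes "matroid M" and "paintable R S M" and "is_minor N M"
  shows "paintable R S N"
proof -
  interpret matroid M by fact
  obtain c d where cd: "painting R S M c d" using assms(2) unfolding paintable_def by blast
  obtain C D where CD: "C \<subseteq> ground M" "D \<subseteq> ground M" "C \<inter> D = {}"
    and N: "N = deletion (contraction M C) D"
    using assms(3) unfolding is_minor_def by blast
  interpret N: matroid N
    unfolding N by (intro matroid.matroid_deletion matroid_contraction)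
  have "\<forall>K\<in>circuits N. \<exists>K'. K' \<in> circuits M \<and> K \<subseteq> K' \<and> K' \<subseteq> K \<union> C"
  proof
    fix K assume "K \<in> circuits N"
    then obtain K' where "K' \<in> circuits M" "K \<subseteq> K'" "K' \<subseteq> K \<union> C"
      unfolding N by (rule circuit_minor_lift[OF _ CD(1)])
    then show "\<exists>K'. K' \<in> circuits M \<and> K \<subseteq> K' \<and> K' \<subseteq> K \<union> C" by blast
  qed
  from bchoice[OF this] obtain k
    where k: "\<forall>K\<in>circuits N. k K \<in> circuits M \<and> K \<subseteq> k K \<and> k K \<subseteq> K \<union> C" ..
  have "\<forall>L\<in>cocircuits N. \<exists>L'. L' \<in> cocircuits M \<and> L \<subseteq> L' \<and> L' \<subseteq> L \<union> D"
  proof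
    fix L assume "L \<in> cocircuits N"
    then obtain L' where "L' \<in> cocircuits M" "L \<subseteq> L'" "L' \<subseteq> L \<union> D"
      unfolding N by (rule cocircuit_minor_lift[OF _ CD(2,3)])
    then show "\<exists>L'. L' \<in> cocircuits M \<and> L \<subseteq> L' \<and> L' \<subseteq> L \<union> D" by blast
  qed
  from bchoice[OF this] obtain l
    where l: "\<forall>L\<in>cocircuits N. l L \<in> cocircuits M \<and> L \<subseteq> l L \<and> l L \<subseteq> L \<union> D" ..
  have ground: "ground N = ground M - C - D"
    by (simp add: N deletion_def ground_contraction)
  \<comment> \<open>Lifting enlarges \<open>K\<close> only within \<open>C\<close> and
    \<open>L\<close> only within \<open>D\<close>. These are disjoint from each other and from the
    ground set of \<open>N\<close>, so no new common element arises and the sums are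
    unchanged.\<close>
  have inter: "k K \<inter> l L = K \<inter> L" if "K \<in> circuits N" "L \<in> cocircuits N" for K L
  proof -
    have "K \<subseteq> ground N" "L \<subseteq> ground N"
      using that N.circuit_subset_ground matroid.circuit_subset_ground[OF N.matroid_dual]
      unfolding cocircuits_def by auto
    then show ?thesis using bspec[OF k that(1)] bspec[OF l that(2)] CD(3) unfolding ground by blast
  qed
  have "painting R S N (c \<circ> k) (d \<circ> l)"
    unfolding painting_def
  proof (intro conjI ballI)
    show "(c \<circ> k) K \<in> K \<rightarrow> S" if "K \<in> circuits N" for K
      using painting_circuit_closed[OF cd, of "k K"] bspec[OF k that] by auto
    show "(d \<circ> l) L \<in> L \<rightarrow> S" if "L \<in> cocircuits N" for L
      using painting_cocircuit_closed[OF cd, of "l L"] bspec[OF l that] by auto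
  next
    fix K L assume KL: "K \<in> circuits N" "L \<in> cocircuits N"
    then have *: "k K \<in> circuits M" "l L \<in> cocircuits M" using k l by blast+
    show "finite {e \<in> K \<inter> L. (c \<circ> k) K e \<otimes>\<^bsub>R\<^esub> (d \<circ> l) L e \<noteq> \<zero>\<^bsub>R\<^esub>}"
      "(\<Oplus>\<^bsub>R\<^esub>e\<in>{e \<in> K \<inter> L. (c \<circ> k) K e \<otimes>\<^bsub>R\<^esub> (d \<circ> l) L e \<noteq> \<zero>\<^bsub>R\<^esub>}.
          (c \<circ> k) K e \<otimes>\<^bsub>R\<^esub> (d \<circ> l) L e) = \<zero>\<^bsub>R\<^esub>"
      unfolding inter[OF KL, symmetric] o_apply by (rule painting_orthogonal[OF cd *])+
  qed
  then show ?thesis unfolding paintable_def by blast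
qed

text \<open>Transfers an orthogonality sum between colourings that agree on the intersection. Values
  in \<open>S\<close> keep the products in the carrier, as congruence for \<open>finsum\<close>
  requires.\<close>

lemma orthogonality_sum_cong:
  assumes "ring R" and "S \<subseteq> carrier R" and "Y = X"
    and "\<And>e. e \<in> X \<Longrightarrow> f e \<in> S" "\<And>e. e \<in> X \<Longrightarrow> g e \<in> S"
    and "\<And>e. e \<in> X \<Longrightarrow> f' e = f e" "\<And>e. e \<in> X \<Longrightarrow> g' e = g e"
  shows "(\<Oplus>\<^bsub>R\<^esub>e\<in>{e \<in> Y. f' e \<otimes>\<^bsub>R\<^esub> g' e \<noteq> \<zero>\<^bsub>R\<^esub>}. f' e \<otimes>\<^bsub>R\<^esub> g' e) =
    (\<Oplus>\<^bsub>R\<^esub>e\<in>{e \<in> X. f e \<otimes>\<^bsub>R\<^esub> g e \<noteq> \<zero>\<^bsub>R\<^esub>}. f e \<otimes>\<^bsub>R\<^esub> g e)"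
proof -
  interpret ring R by fact
  show ?thesis
  proof (rule finsum_cong')
    show "{e \<in> Y. f' e \<otimes>\<^bsub>R\<^esub> g' e \<noteq> \<zero>\<^bsub>R\<^esub>} = {e \<in> X. f e \<otimes>\<^bsub>R\<^esub> g e \<noteq> \<zero>\<^bsub>R\<^esub>}"
      using assms(3,6,7) by auto
    show "(\<lambda>e. f e \<otimes>\<^bsub>R\<^esub> g e) \<in> {e \<in> X. f e \<otimes>\<^bsub>R\<^esub> g e \<noteq> \<zero>\<^bsub>R\<^esub>} \<rightarrow> carrier R"
      using assms(2,4,5) by auto
  qed (use assms(6,7) in auto)
qed

theorem theorem5p3:
  fixes R :: "('r, 'm) ring_scheme" and S :: "'r set" and M :: "'a set_system"
  assumes "partial_field R S" and "finite S"
    and "matroid M" and "tame M"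
  shows "paintable R S M \<longleftrightarrow> (\<forall>N. finite_minor N M \<longrightarrow> paintable R S N)"
proof
  assume "paintable R S M"
  then show "\<forall>N. finite_minor N M \<longrightarrow> paintable R S N"
    using paintable_minor[OF assms(3)] unfolding finite_minor_def by blast
next
  assume minors: "\<forall>N. finite_minor N M \<longrightarrow> paintable R S N"
  interpret matroid M by fact
  have ring: "ring R" and sub: "subgroup S (units_of R)"
    using assms(1) unfolding partial_field_def by blast+
  interpret R: ring R by (rule ring)
  have S: "S \<subseteq> carrier R" "\<one>\<^bsub>R\<^esub> \<in> S"
    using subgroup.subset[OF sub] subgroup.one_closed[OF sub]
    by (auto simp: units_of_def Units_def)
  \<comment> \<open>A candidate painting is encoded as a single function: \<open>Inl (K, e)\<close>
    indexes the colour of \<open>e\<close> in the circuit \<open>K\<close>, and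
    \<open>Inr (L, e)\<close> that in the cocircuit \<open>L\<close>. The constraint for a pair
    reads only the coordinates in \<open>?J\<close>, finitely many by tameness.\<close>
  let ?orth = "\<lambda>(K, L) f. (\<Oplus>\<^bsub>R\<^esub>e\<in>{e \<in> K \<inter> L. f (Inl (K, e)) \<otimes>\<^bsub>R\<^esub> f (Inr (L, e)) \<noteq> \<zero>\<^bsub>R\<^esub>}.
      f (Inl (K, e)) \<otimes>\<^bsub>R\<^esub> f (Inr (L, e))) = \<zero>\<^bsub>R\<^esub>"
  let ?A = "circuits M \<times> cocircuits M"
  let ?J = "\<lambda>(K, L). (\<lambda>e. Inl (K, e)) ` (K \<inter> L) \<union> (\<lambda>e. Inr (L, e)) ` (K \<inter> L)"
  have "\<exists>f :: ('a set \<times> 'a) + ('a set \<times> 'a) \<Rightarrow> 'r. range f \<subseteq> S \<and> (\<forall>k\<in>?A. ?orth k f)"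
  proof (rule local_constraints_compactness[where J = ?J, OF assms(2)])
    show "finite (?J k)" if "k \<in> ?A" for k
      using that assms(4) unfolding tame_def by auto
  next
    fix k and f g :: "('a set \<times> 'a) + ('a set \<times> 'a) \<Rightarrow> 'r"
    assume ran: "range f \<subseteq> S" "range g \<subseteq> S"
      and fg: "\<And>i. i \<in> ?J k \<Longrightarrow> f i = g i" and f: "?orth k f"
    obtain K L where k: "k = (K, L)" by (cases k)
    have eq: "g (Inl (K, e)) = f (Inl (K, e))" "g (Inr (L, e)) = f (Inr (L, e))" if "e \<in> K \<inter> L" for e
      using fg[of "Inl (K, e)"] fg[of "Inr (L, e)"] that by (auto simp: k)
    have "(\<Oplus>\<^bsub>R\<^esub>e\<in>{e \<in> K \<inter> L. g (Inl (K, e)) \<otimes>\<^bsub>R\<^esub> g (Inr (L, e)) \<noteq> \<zero>\<^bsub>R\<^esub>}.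
          g (Inl (K, e)) \<otimes>\<^bsub>R\<^esub> g (Inr (L, e))) =
        (\<Oplus>\<^bsub>R\<^esub>e\<in>{e \<in> K \<inter> L. f (Inl (K, e)) \<otimes>\<^bsub>R\<^esub> f (Inr (L, e)) \<noteq> \<zero>\<^bsub>R\<^esub>}.
          f (Inl (K, e)) \<otimes>\<^bsub>R\<^esub> f (Inr (L, e)))"
      using ran eq by (intro orthogonality_sum_cong[OF ring S(1) refl]) blast+
    then show "?orth k g" using f by (simp add: k)
  next
    fix A' assume A': "finite A'" "A' \<subseteq> ?A"
    define \<O> where "\<O> = fst ` A'"
    define \<B> where "\<B> = snd ` A'"
    have "finite \<O>" "\<O> \<subseteq> circuits M" "finite \<B>" "\<B> \<subseteq> cocircuits M"
      using A' unfolding \<O>_def \<B>_def by auto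
    from finite_minor_tracing[OF assms(4) this] obtain N where N: "finite_minor N M"
      and K: "\<forall>K\<in>\<O>. K \<inter> \<Union>\<B> \<noteq> {} \<longrightarrow> (\<exists>K'\<in>circuits N. K \<inter> \<Union>\<B> \<subseteq> K' \<and> K' \<subseteq> K)"
      and L: "\<forall>L\<in>\<B>. L \<inter> \<Union>\<O> \<noteq> {} \<longrightarrow> (\<exists>L'\<in>cocircuits N. L \<inter> \<Union>\<O> \<subseteq> L' \<and> L' \<subseteq> L)"
      by blast
    obtain c d where cd: "painting R S N c d" using minors N unfolding paintable_def by blast
    obtain k where k: "\<And>K. K \<in> \<O> \<Longrightarrow> K \<inter> \<Union>\<B> \<noteq> {} \<Longrightarrow>
        k K \<in> circuits N \<and> K \<inter> \<Union>\<B> \<subseteq> k K \<and> k K \<subseteq> K"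
      using K by metis
    obtain l where l: "\<And>L. L \<in> \<B> \<Longrightarrow> L \<inter> \<Union>\<O> \<noteq> {} \<Longrightarrow>
        l L \<in> cocircuits N \<and> L \<inter> \<Union>\<O> \<subseteq> l L \<and> l L \<subseteq> L"
      using L by metis
    \<comment> \<open>Colours are copied from the painting of \<open>N\<close> on the traces; every
      other coordinate gets the default one, which lies in \<open>S\<close> and is read by none of
      the constraints in \<open>A'\<close>.\<close>
    define f where "f = case_sum
      (\<lambda>(K, e). if K \<in> \<O> \<and> e \<in> K \<inter> \<Union>\<B> then c (k K) e else \<one>\<^bsub>R\<^esub>)
      (\<lambda>(L, e). if L \<in> \<B> \<and> e \<in> L \<inter> \<Union>\<O> then d (l L) e else \<one>\<^bsub>R\<^esub>)"
    have c: "c (k K) e \<in> S" if "K \<in> \<O>" "e \<in> K \<inter> \<Union>\<B>" for K e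
    proof -
      have "k K \<in> circuits N" "e \<in> k K" using k[OF that(1)] that(2) by blast+
      then show ?thesis by (rule painting_circuit_closed[OF cd])
    qed
    have d: "d (l L) e \<in> S" if "L \<in> \<B>" "e \<in> L \<inter> \<Union>\<O>" for L e
    proof -
      have "l L \<in> cocircuits N" "e \<in> l L" using l[OF that(1)] that(2) by blast+
      then show ?thesis by (rule painting_cocircuit_closed[OF cd])
    qed
    have "f i \<in> S" for i
      using c d S(2) unfolding f_def by (auto split: sum.split prod.split)
    moreover have "?orth p f" if p: "p \<in> A'" for p
    proof -
      obtain K L where KL: "p = (K, L)" by (cases p)
      have mem: "K \<in> \<O>" "L \<in> \<B>" using p KL unfolding \<O>_def \<B>_def by force+
      show ?thesis
      \<comment> \<open>If \<open>K\<close> and \<open>L\<close> are disjoint, a trace may be empty,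
        so \<open>k K\<close> or \<open>l L\<close> may be unspecified; but then the sum is
        empty.\<close>
      proof (cases "K \<inter> L = {}")
        case True
        then show ?thesis unfolding KL prod.case True by simp
      next
        case False
        have ne: "K \<inter> \<Union>\<B> \<noteq> {}" "L \<inter> \<Union>\<O> \<noteq> {}" using False mem by blast+
        note kK = k[OF mem(1) ne(1)] and lL = l[OF mem(2) ne(2)]
        \<comment> \<open>An element common to \<open>K\<close> and \<open>L\<close> belongs to both
          traces, hence to \<open>k K\<close> and \<open>l L\<close>, which in turn are contained in
          \<open>K\<close> and \<open>L\<close>.\<close>
        have eq: "K \<inter> L = k K \<inter> l L" using kK lL mem by blast
        have f: "f (Inl (K, e)) = c (k K) e" "f (Inr (L, e)) = d (l L) e" if "e \<in> k K \<inter> l L" for e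
        proof -
          have "e \<in> K \<inter> \<Union>\<B>" "e \<in> L \<inter> \<Union>\<O>" using that eq mem by blast+
          then show "f (Inl (K, e)) = c (k K) e" "f (Inr (L, e)) = d (l L) e"
            using mem unfolding f_def by auto
        qed
        have "(\<Oplus>\<^bsub>R\<^esub>e\<in>{e \<in> K \<inter> L. f (Inl (K, e)) \<otimes>\<^bsub>R\<^esub> f (Inr (L, e)) \<noteq> \<zero>\<^bsub>R\<^esub>}.
              f (Inl (K, e)) \<otimes>\<^bsub>R\<^esub> f (Inr (L, e))) =
            (\<Oplus>\<^bsub>R\<^esub>e\<in>{e \<in> k K \<inter> l L. c (k K) e \<otimes>\<^bsub>R\<^esub> d (l L) e \<noteq> \<zero>\<^bsub>R\<^esub>}.
              c (k K) e \<otimes>\<^bsub>R\<^esub> d (l L) e)"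
        proof (rule orthogonality_sum_cong[OF ring S(1) eq])
          show "c (k K) e \<in> S" "d (l L) e \<in> S" if "e \<in> k K \<inter> l L" for e
            using painting_circuit_closed[OF cd, of "k K" e] kK
              painting_cocircuit_closed[OF cd, of "l L" e] lL that by blast+
        qed (rule f, assumption)+
        also have "\<dots> = \<zero>\<^bsub>R\<^esub>" using painting_orthogonal(2)[OF cd] kK lL by blast
        finally show ?thesis by (simp add: KL)
      qed
    qed
    ultimately show "\<exists>f. range f \<subseteq> S \<and> (\<forall>k\<in>A'. ?orth k f)"
      by (intro exI[of _ f] conjI ballI image_subsetI)
  qed
  then obtain f :: "('a set \<times> 'a) + ('a set \<times> 'a) \<Rightarrow> 'r"
    where f: "range f \<subseteq> S" "\<forall>k\<in>?A. ?orth k f"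
    by (elim exE conjE)
  have "painting R S M (\<lambda>K e. f (Inl (K, e))) (\<lambda>L e. f (Inr (L, e)))"
    unfolding painting_def
  proof (intro conjI ballI)
    fix K L assume KL: "K \<in> circuits M" "L \<in> cocircuits M"
    then have "finite (K \<inter> L)" using assms(4) unfolding tame_def by blast
    then show "finite {e \<in> K \<inter> L. f (Inl (K, e)) \<otimes>\<^bsub>R\<^esub> f (Inr (L, e)) \<noteq> \<zero>\<^bsub>R\<^esub>}"
      by (rule rev_finite_subset) (rule Collect_restrict)
    show "(\<Oplus>\<^bsub>R\<^esub>e\<in>{e \<in> K \<inter> L. f (Inl (K, e)) \<otimes>\<^bsub>R\<^esub> f (Inr (L, e)) \<noteq> \<zero>\<^bsub>R\<^esub>}.
        f (Inl (K, e)) \<otimes>\<^bsub>R\<^esub> f (Inr (L, e))) = \<zero>\<^bsub>R\<^esub>"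
      using bspec[OF f(2) SigmaI[OF KL]] unfolding prod.case .
  qed (use f(1) in auto)
  then show "paintable R S M" unfolding paintable_def by blast
qed

end
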